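(* Let $n\ge1$, let $\lambda_1,\dots,\lambda_n\in\mathbb{D}\setminus\{0\}$ and let $B(z)=\prod_{i=1}^n\frac{z-\lambda_i}{1-\bar\lambda_iz}$. Then $$\phi(\lambda_1,\dots,\lambda_n)\;\ge\;\frac{1}{\|(1-z^2)B\|_{l_\infty^A}}-\prod_{i=1}^n|\lambda_i|.$$
   Context: $\mathbb{D}$ is the open unit disk. For a holomorphic function $f=\sum_{k\ge0}\hat f(k)z^k$ on $\mathbb{D}$ put $\|f\|_{l_\infty^A}:=\sup_{k\ge0}|\hat f(k)|$ and $\|f\|_W:=\sum_{k\ge0}|\hat f(k)|$; the Wiener algebra $W$ is the set of such $f$ with $\|f\|_W<\infty$. For $(\lambda_1,\dots,\lambda_n)\in\mathbb{D}^n$, $$\phi(\lambda_1,\dots,\lambda_n):=\inf\Big\{\|h\|_W-|h(0)| \;:\; h\in W,\ h(0)=\prod_{i=1}^n\lambda_i,\ h(\lambda_i)=0,\ i=1,\dots,n\Big\},$$ where the zeros are counted with multiplicity (a value occurring $k$ times among the $\lambda_i$ must be a zero of $h$ of order at least $k$). *)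

theory Defs
  imports "HOL-Analysis.Analysis"
begin

text \<open>
  A holomorphic function on the open unit disc is represented by a function
  \<open>f :: complex \<Rightarrow> complex\<close> with \<open>f holomorphic_on ball 0 1\<close>; its values outside the disc
  are irrelevant to everything below.
\<close>

definition taylor_coeff :: "(complex \<Rightarrow> complex) \<Rightarrow> nat \<Rightarrow> complex" where
  "taylor_coeff f k = (deriv ^^ k) f 0 / fact k"

text \<open>
  The supremum is taken in the reals, so this is the norm only for functions with bounded
  Taylor coefficients; that covers \<open>(1 - z\<^sup>2) * B z\<close> for a finite Blaschke product \<open>B\<close>, which is
  bounded on the disc.
\<close>

definition linf_norm :: "(complex \<Rightarrow> complex) \<Rightarrow> real" where
  "linf_norm f = (SUP k. norm (taylor_coeff f k))"

definition wiener_algebra :: "(complex \<Rightarrow> complex) set" where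
  "wiener_algebra =
     {f. f holomorphic_on ball 0 1 \<and> summable (\<lambda>k. norm (taylor_coeff f k))}"

definition wiener_norm :: "(complex \<Rightarrow> complex) \<Rightarrow> real" where
  "wiener_norm f = (\<Sum>k. norm (taylor_coeff f k))"

text \<open>
  For \<open>k = 0\<close> this is no condition, and the zero function has zeros of every order.
\<close>

definition zero_of_order_at_least :: "(complex \<Rightarrow> complex) \<Rightarrow> complex \<Rightarrow> nat \<Rightarrow> bool" where
  "zero_of_order_at_least h a k \<longleftrightarrow> (\<forall>j<k. (deriv ^^ j) h a = 0)"

text \<open>
  The infimum is over a nonempty set of reals, since \<open>h z = (\<Prod>i=1..n. (l i - z))\<close> is admissible,
  and it is bounded below by \<open>0\<close>, since \<open>norm (h 0)\<close> is one of the terms of \<open>wiener_norm h\<close>.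
\<close>

definition phi :: "nat \<Rightarrow> (nat \<Rightarrow> complex) \<Rightarrow> real" where
  "phi n l = Inf {wiener_norm h - norm (h 0) | h.
     h \<in> wiener_algebra \<and> h 0 = (\<Prod>i=1..n. l i) \<and>
     (\<forall>i\<in>{1..n}. zero_of_order_at_least h (l i) (card {j\<in>{1..n}. l j = l i}))}"

definition blaschke_product :: "nat \<Rightarrow> (nat \<Rightarrow> complex) \<Rightarrow> complex \<Rightarrow> complex" where
  "blaschke_product n l z = (\<Prod>i=1..n. (z - l i) / (1 - cnj (l i) * z))"

end

theory Submission
  imports Defs "HOL-Complex_Analysis.Complex_Analysis"
begin

text \<open>
  The bound comes from duality between absolutely summable and bounded coefficient sequences.
  Write \<open>B\<close> also for the power series of the Blaschke product, \<open>b\<^sub>k\<close> for its coefficients, and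
  \<open>\<langle>F, G\<rangle> = \<Sum>k. F\<^sub>k * cnj G\<^sub>k\<close> for the \<open>H\<^sup>2\<close> pairing. An admissible \<open>h\<close> vanishes wherever \<open>B\<close>
  does, so \<open>h = B * g\<close> with \<open>g\<close> holomorphic on the disc, and \<open>norm (g 0) = 1\<close> because
  \<open>norm (h 0) = norm (B 0)\<close> is nonzero. Multiplication by the inner function \<open>B\<close> preserves the
  pairing, hence
  \<open>\<langle>(1 - z\<^sup>2) * h, B\<rangle> = \<langle>(1 - z\<^sup>2) * g, 1\<rangle> = g 0\<close>.
  Moving the factor \<open>z\<^sup>2\<close> to the other side turns the left-hand side into
  \<open>\<Sum>k. h\<^sub>k * cnj (b\<^sub>k - b\<^sub>k\<^sub>+\<^sub>2)\<close>. Up to sign, \<open>b\<^sub>k - b\<^sub>k\<^sub>+\<^sub>2\<close> is the coefficient of index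
  \<open>k + 2\<close> of \<open>(1 - z\<^sup>2) * B\<close>. Therefore \<open>1 \<le> wiener_norm h * linf_norm ((1 - z\<^sup>2) * B)\<close>
  (lemma \<open>one_le_wiener_norm_mult_linf_norm\<close>), and subtracting \<open>norm (h 0)\<close> gives the claim.

  Two points need work. The factorisation of \<open>h\<close> is extracted from the vanishing derivatives by
  splitting off one linear factor at a time (\<open>zeros_imp_factor_prod\<close>). The invariance of the
  pairing is proved without boundary values. With \<open>P\<close> the product of the \<open>z - l i\<close> and \<open>D\<close> the
  product of the \<open>1 - cnj (l i) * z\<close>, so that \<open>B = P / D\<close>, the identity
  \<open>\<langle>P * F, P * G\<rangle> = \<langle>D * F, D * G\<rangle>\<close> (\<open>fps_pairing_prod\<close>) only uses that the shift is an
  isometry. It is applied to \<open>F = (1 - z\<^sup>2) * g / D\<close> and \<open>G = 1 / D\<close>. The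
  pairing converges as soon as \<open>F\<close> has radius of convergence at least \<open>1\<close> and \<open>G\<close> has radius
  greater than \<open>1\<close>, so no regularity of \<open>h / P\<close> up to the circle has to be established.
\<close>

section \<open>Zeros with multiplicity\<close>

lemma zero_of_order_at_least_0 [simp]: "zero_of_order_at_least h a 0"
  by (simp add: zero_of_order_at_least_def)

text \<open>
  By the Leibniz rule the \<open>j + 1\<close>-st derivative of \<open>(z - a) * r z\<close> at \<open>a\<close> is \<open>j + 1\<close> times the
  \<open>j\<close>-th derivative of \<open>r\<close>. This lets all arguments about multiplicities proceed one linear
  factor at a time.
\<close>

lemma zero_of_order_at_least_Suc_mult:
  assumes S: "open S" "a \<in> S" and r: "r holomorphic_on S"
    and h: "\<And>z. z \<in> S \<Longrightarrow> h z = (z - a) * r z"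
  shows "zero_of_order_at_least h a (Suc k) \<longleftrightarrow> zero_of_order_at_least r a k"
proof -
  have id: "(deriv ^^ i) (\<lambda>z. z - a) a = (if i = 1 then 1 else 0)" for i
    by (subst higher_deriv_diff[where S = UNIV]) (auto intro: holomorphic_intros)
  have D: "(deriv ^^ Suc j) h a = of_nat (Suc j) * (deriv ^^ j) r a" for j
  proof -
    have "(deriv ^^ Suc j) h a = (deriv ^^ Suc j) (\<lambda>z. (z - a) * r z) a"
      using S h by (intro higher_deriv_cong_ev eventually_nhds_in_open[THEN eventually_mono]) auto
    also have "\<dots> = (\<Sum>i = 0..Suc j. of_nat (Suc j choose i) *
        (deriv ^^ i) (\<lambda>z. z - a) a * (deriv ^^ (Suc j - i)) r a)"
      by (rule higher_deriv_mult[where S = S]) (use S r in \<open>auto intro: holomorphic_intros\<close>)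
    also have "\<dots> = (\<Sum>i = 0..Suc j. if i = 1 then of_nat (Suc j) * (deriv ^^ j) r a else 0)"
      by (intro sum.cong) (auto simp: id)
    finally show ?thesis by simp
  qed
  have "h a = 0" using h[OF S(2)] by simp
  then show ?thesis
    unfolding zero_of_order_at_least_def All_less_Suc2 using D by (auto simp del: funpow.simps(2) of_nat_Suc)
qed

lemma holomorphic_factor_linear:
  assumes "open S" "a \<in> S" "h holomorphic_on S" "h a = 0"
  obtains r where "r holomorphic_on S" "\<And>z. h z = (z - a) * r z"
proof
  show "(\<lambda>z. if z = a then deriv h a else (h z - h a) / (z - a)) holomorphic_on S"
    using assms by (intro pole_lemma_open) auto
qed (use assms in auto)

lemma zero_of_order_at_least_imp_factor:
  assumes S: "open S" "a \<in> S" and "h holomorphic_on S" "zero_of_order_at_least h a k"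
  shows "\<exists>r. r holomorphic_on S \<and> (\<forall>z\<in>S. h z = (z - a) ^ k * r z)"
  using assms(3,4)
proof (induction k arbitrary: h)
  case 0
  then show ?case by auto
next
  case (Suc k)
  have "h a = 0" using Suc.prems(2) by (force simp: zero_of_order_at_least_def)
  then obtain g where g: "g holomorphic_on S" "\<And>z. h z = (z - a) * g z"
    using holomorphic_factor_linear[OF S Suc.prems(1)] by metis
  have "zero_of_order_at_least g a k"
    using zero_of_order_at_least_Suc_mult[OF S g] Suc.prems(2) by simp
  from Suc.IH[OF g(1) this] show ?case using g(2) by auto
qed

lemma factor_imp_zero_of_order_at_least:
  assumes S: "open S" "a \<in> S" and "r holomorphic_on S" "\<And>z. z \<in> S \<Longrightarrow> h z = (z - a) ^ k * r z"
  shows "zero_of_order_at_least h a k"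
  using assms(4)
proof (induction k arbitrary: h)
  case (Suc k)
  have "zero_of_order_at_least (\<lambda>z. (z - a) ^ k * r z) a k"
    using Suc.IH by simp
  moreover have "(\<lambda>z. (z - a) ^ k * r z) holomorphic_on S"
    using assms(3) by (intro holomorphic_intros)
  ultimately show ?case
    using zero_of_order_at_least_Suc_mult[OF S, of "\<lambda>z. (z - a) ^ k * r z" h k] Suc.prems
    by (simp add: mult.assoc)
qed auto

lemma continuous_cancel_linear:
  fixes f g :: "complex \<Rightarrow> complex"
  assumes "open S" "continuous_on S f" "continuous_on S g"
    and "\<And>z. z \<in> S \<Longrightarrow> (z - b) * f z = (z - b) * g z" and z: "z \<in> S"
  shows "f z = g z"
proof (cases "z = b")
  case True
  have "isCont (\<lambda>w. f w - g w) z"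
    using assms by (intro continuous_intros) (auto simp: continuous_on_eq_continuous_at)
  then have "((\<lambda>w. f w - g w) \<longlongrightarrow> f z - g z) (at z)" by (simp add: isCont_def)
  moreover have "\<forall>\<^sub>F w in at z. f w - g w = 0"
    using eventually_at_in_open[OF assms(1) z] by eventually_elim (use assms(4) True in auto)
  then have "((\<lambda>w. f w - g w) \<longlongrightarrow> 0) (at z)" by (rule tendsto_eventually)
  ultimately have "f z - g z = 0" by (metis at_neq_bot tendsto_unique)
  then show ?thesis by simp
qed (use assms in auto)

text \<open>
  In the induction, \<open>h\<close> is divided by \<open>z - l i\<close>. The quotient has lost one order at \<open>l i\<close>; at a
  different point \<open>a\<close> it must keep its order. There \<open>h = (z - a)^m * r\<close>, the cofactor \<open>r\<close> itself
  vanishes at \<open>l i\<close>, and cancelling \<open>z - l i\<close> exhibits \<open>(z - a)^m\<close> as a factor of the quotient.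
\<close>

lemma zeros_imp_factor_prod:
  assumes "finite I" and S: "open S" "\<And>i. i \<in> I \<Longrightarrow> l i \<in> S" and "h holomorphic_on S"
    and "\<And>i. i \<in> I \<Longrightarrow> zero_of_order_at_least h (l i) (card {j \<in> I. l j = l i})"
  shows "\<exists>q. q holomorphic_on S \<and> (\<forall>z\<in>S. h z = (\<Prod>i\<in>I. z - l i) * q z)"
  using assms(1,2,4,5) S(2)
proof (induction I arbitrary: h rule: finite_induct)
  case empty
  then show ?case by auto
next
  case (insert i I)
  let ?m = "\<lambda>a. card {j \<in> I. l j = a}"
  have m: "card {j \<in> insert i I. l j = a} = (if a = l i then Suc (?m a) else ?m a)" for a
  proof (cases "a = l i")
    case True
    then have "{j \<in> insert i I. l j = a} = insert i {j \<in> I. l j = a}" by auto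
    then show ?thesis using insert True by simp
  next
    case False
    then have "{j \<in> insert i I. l j = a} = {j \<in> I. l j = a}" by auto
    then show ?thesis using False by simp
  qed
  have li: "l i \<in> S" using insert.prems by auto
  have "zero_of_order_at_least h (l i) (Suc (?m (l i)))"
    using insert.prems(3)[of i] m by simp
  then have "h (l i) = 0" by (force simp: zero_of_order_at_least_def)
  then obtain g where g: "g holomorphic_on S" "\<And>z. h z = (z - l i) * g z"
    using holomorphic_factor_linear[OF S(1) li insert.prems(2)] by metis
  have "zero_of_order_at_least g (l j) (?m (l j))" if "j \<in> I" for j
  proof (cases "l j = l i")
    case True
    then show ?thesis
      using insert.prems(3)[of j] that m zero_of_order_at_least_Suc_mult[OF S(1) li g] by simp
  next
    case False
    have lj: "l j \<in> S" using that insert.prems by auto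
    have "zero_of_order_at_least h (l j) (?m (l j))"
      using insert.prems(3)[of j] that m False by simp
    then obtain r where r: "r holomorphic_on S" "\<And>z. z \<in> S \<Longrightarrow> h z = (z - l j) ^ ?m (l j) * r z"
      using zero_of_order_at_least_imp_factor[OF S(1) lj insert.prems(2)] by blast
    have "r (l i) = 0" using r(2)[OF li] g(2)[of "l i"] False by simp
    then obtain s where s: "s holomorphic_on S" "\<And>z. r z = (z - l i) * s z"
      using holomorphic_factor_linear[OF S(1) li r(1)] by metis
    have "g z = (z - l j) ^ ?m (l j) * s z" if "z \<in> S" for z
    proof (rule continuous_cancel_linear[OF S(1) _ _ _ that, where b = "l i"])
      show "continuous_on S g" using g by (intro holomorphic_on_imp_continuous_on)
      show "continuous_on S (\<lambda>z. (z - l j) ^ ?m (l j) * s z)"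
        using s by (intro holomorphic_on_imp_continuous_on holomorphic_intros)
      show "(z - l i) * g z = (z - l i) * ((z - l j) ^ ?m (l j) * s z)" if "z \<in> S" for z
        using g(2)[of z] r(2)[OF that] s(2)[of z] by (metis mult.left_commute)
    qed
    then show ?thesis by (rule factor_imp_zero_of_order_at_least[OF S(1) lj s(1)])
  qed
  then obtain q where "q holomorphic_on S" "\<forall>z\<in>S. g z = (\<Prod>i\<in>I. z - l i) * q z"
    using insert.IH[OF _ g(1)] insert.prems by blast
  then show ?case using g(2) insert.hyps by (auto simp: mult.assoc)
qed

section \<open>The Hardy space pairing on power series\<close>

definition fps_pairing :: "complex fps \<Rightarrow> complex fps \<Rightarrow> complex" where
  "fps_pairing F G = (\<Sum>k. fps_nth F k * cnj (fps_nth G k))"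

text \<open>
  For \<open>1 < R\<close> below the radius of \<open>G\<close>, the terms \<open>G\<^sub>k * R^k\<close> are bounded while
  \<open>F\<^sub>k * R^(-k)\<close> is absolutely summable.
\<close>

lemma summable_fps_pairing:
  assumes F: "fps_conv_radius F \<ge> 1" and G: "fps_conv_radius G > 1"
  shows "summable (\<lambda>k. fps_nth F k * cnj (fps_nth G k))"
proof -
  obtain R where R: "ereal R < fps_conv_radius G" "1 < ereal R"
    using G ereal_dense2 by blast
  then have R1: "R > 1" by simp
  have "summable (\<lambda>k. norm (fps_nth G k * of_real R ^ k))"
    using R R1 by (intro abs_summable_in_conv_radius) (simp add: fps_conv_radius_def)
  then have "Bseq (\<lambda>k. norm (fps_nth G k * of_real R ^ k))"
    by (rule summable_imp_Bseq)
  then obtain M where M: "\<And>k. norm (fps_nth G k) * R ^ k \<le> M"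
    using R1 by (auto simp: Bseq_def norm_mult norm_power)
  have "ereal (norm (of_real (1 / R) :: complex)) < 1" using R1 by (simp add: norm_divide)
  also have "\<dots> \<le> conv_radius (fps_nth F)" using F by (simp add: fps_conv_radius_def)
  finally have "summable (\<lambda>k. norm (fps_nth F k * of_real (1 / R) ^ k))"
    by (intro abs_summable_in_conv_radius) 
  then have "summable (\<lambda>k. M * norm (fps_nth F k * of_real (1 / R) ^ k))"
    by (rule summable_mult)
  moreover have "norm (fps_nth F k * cnj (fps_nth G k)) \<le> M * norm (fps_nth F k * of_real (1 / R) ^ k)" for k
  proof -
    have "norm (fps_nth F k * cnj (fps_nth G k)) =
      (norm (fps_nth G k) * R ^ k) * norm (fps_nth F k * of_real (1 / R) ^ k)"
      using R1 by (simp add: norm_mult norm_power norm_divide power_divide)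
    also have "\<dots> \<le> M * norm (fps_nth F k * of_real (1 / R) ^ k)"
      by (intro mult_right_mono M) auto
    finally show ?thesis .
  qed
  ultimately show ?thesis by (rule summable_comparison_test'[where N = 0])
qed

lemma fps_conv_radius_mult_entire:
  assumes "fps_conv_radius P = \<infinity>"
  shows "fps_conv_radius (P * F) \<ge> fps_conv_radius F"
  using fps_conv_radius_mult[of P F] assms by simp

lemma fps_conv_radius_linear [simp]:
  "fps_conv_radius (fps_X - fps_const a :: complex fps) = \<infinity>"
  "fps_conv_radius (1 - fps_const a * fps_X :: complex fps) = \<infinity>"
  using fps_conv_radius_diff[of "fps_X" "fps_const a"]
    fps_conv_radius_diff[of 1 "fps_const a * fps_X"] fps_conv_radius_mult[of "fps_const a" fps_X]
  by auto

lemma fps_conv_radius_prod_infinity: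
  assumes "\<And>i. i \<in> I \<Longrightarrow> fps_conv_radius (F i :: complex fps) = \<infinity>"
  shows "fps_conv_radius (\<Prod>i\<in>I. F i) = \<infinity>"
  using assms
proof (induction I rule: infinite_finite_induct)
  case (insert i I)
  then show ?case using fps_conv_radius_mult[of "F i" "\<Prod>i\<in>I. F i"] by simp
qed auto

text \<open>
  This is the coefficient form of \<open>norm (z - a) = norm (1 - cnj a * z)\<close> on the unit circle: after
  expanding both sides, the termwise difference is \<open>1 - a * cnj a\<close> times the difference between
  the terms of the shifted pairing and those of the original one, and both of these have the
  same sum.
\<close>

lemma fps_pairing_linear_factor:
  assumes F: "fps_conv_radius F \<ge> 1" and G: "fps_conv_radius G > 1"
  shows "fps_pairing ((fps_X - fps_const a) * F) ((fps_X - fps_const a) * G) =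
    fps_pairing ((1 - fps_const (cnj a) * fps_X) * F) ((1 - fps_const (cnj a) * fps_X) * G)"
proof -
  let ?s = "\<lambda>k. fps_nth F k * cnj (fps_nth G k)"
  let ?t = "\<lambda>k. fps_nth (fps_X * F) k * cnj (fps_nth (fps_X * G) k)"
  let ?L = "\<lambda>k. fps_nth ((fps_X - fps_const a) * F) k * cnj (fps_nth ((fps_X - fps_const a) * G) k)"
  let ?R = "\<lambda>k. fps_nth ((1 - fps_const (cnj a) * fps_X) * F) k *
      cnj (fps_nth ((1 - fps_const (cnj a) * fps_X) * G) k)"
  have s: "?s sums fps_pairing F G"
    unfolding fps_pairing_def by (intro summable_sums summable_fps_pairing F G)
  have t: "?t sums fps_pairing F G"
    using s sums_Suc_iff[of ?t "fps_pairing F G"] by simp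
  have "?R sums fps_pairing ((1 - fps_const (cnj a) * fps_X) * F) ((1 - fps_const (cnj a) * fps_X) * G)"
    unfolding fps_pairing_def
    by (intro summable_sums summable_fps_pairing order.trans[OF F]
        order.strict_trans2[OF G] fps_conv_radius_mult_entire) auto
  from sums_add[OF this sums_mult[OF sums_diff[OF t s], of "1 - a * cnj a"]]
  have "(\<lambda>k. ?R k + (1 - a * cnj a) * (?t k - ?s k)) sums
     fps_pairing ((1 - fps_const (cnj a) * fps_X) * F) ((1 - fps_const (cnj a) * fps_X) * G)"
    by simp
  moreover have "?R k + (1 - a * cnj a) * (?t k - ?s k) = ?L k" for k
    by (simp add: left_diff_distrib mult.assoc) (simp add: algebra_simps)
  ultimately show ?thesis by (simp add: fps_pairing_def sums_iff)
qed

lemma fps_pairing_prod: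
  assumes "finite I" "fps_conv_radius F \<ge> 1" "fps_conv_radius G > 1"
  shows "fps_pairing ((\<Prod>i\<in>I. fps_X - fps_const (l i)) * F) ((\<Prod>i\<in>I. fps_X - fps_const (l i)) * G) =
    fps_pairing ((\<Prod>i\<in>I. 1 - fps_const (cnj (l i)) * fps_X) * F)
      ((\<Prod>i\<in>I. 1 - fps_const (cnj (l i)) * fps_X) * G)"
  using assms
proof (induction I arbitrary: F G rule: finite_induct)
  case (insert i I)
  let ?p = "\<lambda>i. fps_X - fps_const (l i)" and ?d = "\<lambda>i. 1 - fps_const (cnj (l i)) * fps_X"
  let ?P = "\<Prod>i\<in>I. ?p i" and ?D = "\<Prod>i\<in>I. ?d i"
  have rad: "fps_conv_radius (?p i * H) \<ge> fps_conv_radius H"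
    "fps_conv_radius (?D * H) \<ge> fps_conv_radius H" for H
    by (intro fps_conv_radius_mult_entire fps_conv_radius_prod_infinity; simp)+
  have "fps_pairing (?P * (?p i * F)) (?P * (?p i * G)) = fps_pairing (?D * (?p i * F)) (?D * (?p i * G))"
    by (intro insert.IH order.trans[OF insert.prems(1)] less_le_trans[OF insert.prems(2)] rad)
  also have "\<dots> = fps_pairing (?p i * (?D * F)) (?p i * (?D * G))"
    by (simp only: mult.left_commute)
  also have "\<dots> = fps_pairing (?d i * (?D * F)) (?d i * (?D * G))"
    by (intro fps_pairing_linear_factor order.trans[OF insert.prems(1)] less_le_trans[OF insert.prems(2)] rad)
  finally show ?case using insert.hyps by (simp add: mult.assoc mult.left_commute)
qed auto

lemma fps_pairing_1_right [simp]: "fps_pairing F 1 = fps_nth F 0"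
proof -
  have "fps_pairing F 1 = (\<Sum>k\<in>{0}. fps_nth F k * cnj (fps_nth 1 k))"
    unfolding fps_pairing_def by (rule suminf_finite) auto
  then show ?thesis by simp
qed

lemma fps_nth_0_prod_eq_1:
  fixes F :: "'b \<Rightarrow> 'a :: comm_ring_1 fps"
  assumes "\<And>i. i \<in> I \<Longrightarrow> fps_nth (F i) 0 = 1"
  shows "fps_nth (\<Prod>i\<in>I. F i) 0 = 1"
  using assms by (induction I rule: infinite_finite_induct) auto

section \<open>The Blaschke product\<close>

lemma fps_conv_radius_inverse_linear:
  assumes "norm (c :: complex) < 1"
  shows "fps_conv_radius (inverse (1 - fps_const c * fps_X)) > 1"
proof -
  \<comment> \<open>any \<open>r\<close> strictly between \<open>1\<close> and \<open>1 / norm c\<close> would do; this one also covers \<open>c = 0\<close>\<close>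
  define r where "r = 2 / (1 + norm c)"
  have r: "r > 1" "norm c * r < 1"
    using assms by (auto simp: r_def field_simps add_pos_nonneg)
  have "inverse (1 - fps_const c * fps_X) = Abs_fps (\<lambda>n. c ^ n)"
  proof (rule fps_inverse_unique)
    show "(1 - fps_const c * fps_X) * Abs_fps (\<lambda>n. c ^ n) = 1"
    proof (rule fps_ext)
      fix n
      show "fps_nth ((1 - fps_const c * fps_X) * Abs_fps (\<lambda>n. c ^ n)) n = fps_nth 1 n"
        by (cases n) (auto simp: left_diff_distrib mult.assoc)
    qed
  qed
  moreover have "conv_radius (\<lambda>n. c ^ n) \<ge> norm (complex_of_real r)"
  proof (rule conv_radius_geI)
    have "summable (\<lambda>n. (c * complex_of_real r) ^ n)"
      using r by (intro summable_geometric) (simp add: norm_mult)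
    then show "summable (\<lambda>n. c ^ n * complex_of_real r ^ n)" by (simp add: power_mult_distrib)
  qed
  ultimately have "ereal r \<le> fps_conv_radius (inverse (1 - fps_const c * fps_X))"
    using r by (simp add: fps_conv_radius_def)
  moreover have "1 < ereal r" using r by simp
  ultimately show ?thesis by (rule less_le_trans[rotated])
qed

lemma fps_conv_radius_prod_gt:
  assumes "\<And>i. i \<in> I \<Longrightarrow> fps_conv_radius (F i :: complex fps) > r" "r < \<infinity>"
  shows "fps_conv_radius (\<Prod>i\<in>I. F i) > r"
  using assms
proof (induction I rule: infinite_finite_induct)
  case (insert i I)
  then have "r < min (fps_conv_radius (F i)) (fps_conv_radius (\<Prod>i\<in>I. F i))" by simp
  also have "\<dots> \<le> fps_conv_radius (F i * (\<Prod>i\<in>I. F i))" by (rule fps_conv_radius_mult)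
  finally show ?case using insert.hyps by simp
qed auto

definition blaschke_fps :: "nat \<Rightarrow> (nat \<Rightarrow> complex) \<Rightarrow> complex fps" where
  "blaschke_fps n l = (\<Prod>i=1..n. fps_X - fps_const (l i)) *
     (\<Prod>i=1..n. inverse (1 - fps_const (cnj (l i)) * fps_X))"

lemma has_fps_expansion_blaschke:
  "(\<lambda>z. (1 - z\<^sup>2) * blaschke_product n l z) has_fps_expansion (1 - fps_X ^ 2) * blaschke_fps n l"
proof -
  have "(\<lambda>z. (1 - z\<^sup>2) * (\<Prod>i=1..n. (z - l i) * inverse (1 - cnj (l i) * z))) has_fps_expansion
    (1 - fps_X ^ 2) * (\<Prod>i=1..n. (fps_X - fps_const (l i)) * inverse (1 - fps_const (cnj (l i)) * fps_X))"
    by (intro has_fps_expansion_mult has_fps_expansion_diff has_fps_expansion_prod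
        has_fps_expansion_inverse has_fps_expansion_const has_fps_expansion_1
        has_fps_expansion_fps_X has_fps_expansion_fps_X_power) auto
  then show ?thesis by (simp add: blaschke_fps_def blaschke_product_def divide_inverse prod.distrib)
qed

lemma fps_conv_radius_blaschke:
  assumes "\<And>i. i \<in> {1..n} \<Longrightarrow> norm (l i) < 1"
  shows "fps_conv_radius (blaschke_fps n l) > 1"
  unfolding blaschke_fps_def
  by (intro less_le_trans[OF _ fps_conv_radius_mult_entire] fps_conv_radius_prod_gt
      fps_conv_radius_inverse_linear fps_conv_radius_prod_infinity) (use assms in auto)

lemma summable_norm_fps_nth:
  assumes "fps_conv_radius (F :: complex fps) > 1"
  shows "summable (\<lambda>k. norm (fps_nth F k))"
  using abs_summable_in_conv_radius[of 1 "fps_nth F"] assms by (simp add: fps_conv_radius_def one_ereal_def)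

text \<open>
  The supremum defining \<open>linf_norm\<close> is a genuine one here: the poles of the Blaschke product lie
  outside the closed disc, so the coefficients are even summable.
\<close>

lemma norm_blaschke_diff_le:
  assumes "\<And>i. i \<in> {1..n} \<Longrightarrow> norm (l i) < 1"
  shows "norm (fps_nth (blaschke_fps n l) k - fps_nth (blaschke_fps n l) (k + 2)) \<le>
    linf_norm (\<lambda>z. (1 - z\<^sup>2) * blaschke_product n l z)"
proof -
  let ?B = "blaschke_fps n l"
  let ?C = "(1 - fps_X ^ 2) * ?B"
  have tc: "taylor_coeff (\<lambda>z. (1 - z\<^sup>2) * blaschke_product n l z) k = fps_nth ?C k" for k
    unfolding taylor_coeff_def using fps_nth_fps_expansion[OF has_fps_expansion_blaschke] by simp
  have "fps_conv_radius (1 - fps_X ^ 2 :: complex fps) = \<infinity>"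
    using fps_conv_radius_diff[of 1 "fps_X ^ 2 :: complex fps"] by simp
  from fps_conv_radius_mult_entire[OF this, of ?B]
  have "fps_conv_radius ?C > 1" using fps_conv_radius_blaschke[OF assms] by (rule less_le_trans[rotated])
  from summable_norm_fps_nth[OF this]
  have "Bseq (\<lambda>k. norm (fps_nth ?C k))"
    by (rule summable_imp_Bseq)
  then have bdd: "bdd_above (range (\<lambda>k. norm (fps_nth ?C k)))"
    by (auto simp: Bseq_def bdd_above_def)
  have "norm (fps_nth ?B k - fps_nth ?B (k + 2)) = norm (fps_nth ?C (k + 2))"
    by (simp add: left_diff_distrib fps_X_power_mult_nth norm_minus_commute)
  also have "\<dots> \<le> (SUP k. norm (fps_nth ?C k))" by (rule cSUP_upper[OF _ bdd]) simp
  finally show ?thesis by (simp add: linf_norm_def tc)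
qed

section \<open>The lower bound\<close>

lemma one_le_wiener_norm_mult_linf_norm:
  assumes l: "\<And>i. i \<in> {1..n} \<Longrightarrow> norm (l i) < 1" "\<And>i. i \<in> {1..n} \<Longrightarrow> l i \<noteq> 0"
    and h: "h \<in> wiener_algebra" "h 0 = (\<Prod>i=1..n. l i)"
    and z: "\<And>i. i \<in> {1..n} \<Longrightarrow> zero_of_order_at_least h (l i) (card {j\<in>{1..n}. l j = l i})"
  shows "1 \<le> wiener_norm h * linf_norm (\<lambda>z. (1 - z\<^sup>2) * blaschke_product n l z)"
proof -
  let ?N = "linf_norm (\<lambda>z. (1 - z\<^sup>2) * blaschke_product n l z)"
  let ?P = "\<Prod>i=1..n. fps_X - fps_const (l i)"
  let ?D = "\<Prod>i=1..n. 1 - fps_const (cnj (l i)) * fps_X"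
  let ?E = "\<Prod>i=1..n. inverse (1 - fps_const (cnj (l i)) * fps_X)"
  let ?B = "blaschke_fps n l"
  define H where "H = fps_expansion h 0"
  have hol: "h holomorphic_on ball 0 1" and sm: "summable (\<lambda>k. norm (taylor_coeff h k))"
    using h by (auto simp: wiener_algebra_def)
  have nthH: "fps_nth H k = taylor_coeff h k" for k
    by (simp add: H_def fps_expansion_def taylor_coeff_def)
  obtain q where q: "q holomorphic_on ball 0 1" "\<And>z. z \<in> ball 0 1 \<Longrightarrow> h z = (\<Prod>i=1..n. z - l i) * q z"
    using zeros_imp_factor_prod[of "{1..n}" "ball 0 1" l h] hol l z by auto
  define Q where "Q = fps_expansion q 0"
  have "h has_fps_expansion H" unfolding H_def
    by (rule has_fps_expansion_fps_expansion[of "ball 0 1"]) (use hol in auto)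
  have Qexp: "q has_fps_expansion Q" unfolding Q_def
    by (rule has_fps_expansion_fps_expansion[of "ball 0 1"]) (use q in auto)
  have Qrad: "fps_conv_radius Q \<ge> 1" 
    using q(1) holomorphic_on_imp_fps_conv_radius_ge[OF Qexp, of 1]
    by (simp add: one_ereal_def)
  have "(\<lambda>z. (\<Prod>i=1..n. z - l i) * q z) has_fps_expansion ?P * Q"
    by (intro fps_expansion_intros Qexp)
  moreover have eq: "\<forall>\<^sub>F z in nhds 0. (\<Prod>i=1..n. z - l i) * q z = h z"
    using eventually_nhds_in_open[of "ball 0 1" 0] by (rule eventually_mono) (use q in auto)
  ultimately have "h has_fps_expansion ?P * Q"
    using has_fps_expansion_cong[OF eq refl, of "?P * Q"] by simp
  then have HPQ: "H = ?P * Q"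
    unfolding H_def by (rule fps_expansion_eqI)
  have Hrad: "fps_conv_radius H \<ge> 1"
    unfolding HPQ by (intro order.trans[OF Qrad] fps_conv_radius_mult_entire fps_conv_radius_prod_infinity) auto
  have Brad: "fps_conv_radius ?B > 1" using l by (intro fps_conv_radius_blaschke) auto
  have Erad: "fps_conv_radius ?E > 1"
    by (intro fps_conv_radius_prod_gt fps_conv_radius_inverse_linear) (use l in auto)
  have DE: "?D * ?E = 1"
    unfolding prod.distrib[symmetric] by (intro prod.neutral ballI) (simp add: inverse_mult_eq_1')
  have X2: "fps_conv_radius (1 - fps_X ^ 2 :: complex fps) = \<infinity>"
    using fps_conv_radius_diff[of 1 "fps_X ^ 2 :: complex fps"] by simp
  \<comment> \<open>Here \<open>H = ?P * Q\<close> and \<open>?B = ?P * ?E\<close> share the factor \<open>?P\<close>, which is traded for \<open>?D = 1 / ?E\<close>.\<close>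
  have "fps_pairing ((1 - fps_X ^ 2) * H) ?B = fps_pairing (?P * ((1 - fps_X ^ 2) * Q)) (?P * ?E)"
    by (simp add: HPQ blaschke_fps_def mult.left_commute)
  also have "\<dots> = fps_pairing (?D * ((1 - fps_X ^ 2) * Q)) (?D * ?E)"
    by (intro fps_pairing_prod order.trans[OF Qrad] fps_conv_radius_mult_entire Erad X2) auto
  also have "\<dots> = fps_nth ?D 0 * fps_nth Q 0" unfolding DE by simp
  also have "fps_nth ?D 0 = 1" by (rule fps_nth_0_prod_eq_1) simp
  finally have pair: "fps_pairing ((1 - fps_X ^ 2) * H) ?B = fps_nth Q 0" by simp
  have "norm (fps_nth Q 0) = 1"
  proof -
    have "norm (h 0) = norm (\<Prod>i=1..n. 0 - l i) * norm (q 0)" using q(2)[of 0] by (simp add: norm_mult)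
    then have "(\<Prod>i=1..n. norm (l i)) = (\<Prod>i=1..n. norm (l i)) * norm (q 0)" 
      using h(2) by (simp add: prod_norm flip: prod_norm)
    moreover have "(\<Prod>i=1..n. norm (l i)) \<noteq> 0" using l by simp
    ultimately show ?thesis by (simp add: Q_def fps_expansion_def)
  qed
  moreover have "fps_pairing ((1 - fps_X ^ 2) * H) ?B =
    (\<Sum>k. fps_nth H k * cnj (fps_nth ?B k - fps_nth ?B (k + 2)))"
  proof -
    \<comment> \<open>The adjoint of multiplication by \<open>z\<^sup>2\<close> is the backward shift by two places.\<close>
    let ?t = "\<lambda>k. fps_nth (fps_X ^ 2 * H) k * cnj (fps_nth ?B k)"
    have st: "summable ?t"
      by (intro summable_fps_pairing Brad order.trans[OF Hrad] fps_conv_radius_mult_entire) simp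
    have sH: "summable (\<lambda>k. fps_nth H k * cnj (fps_nth ?B k))" by (intro summable_fps_pairing Brad Hrad)
    have "fps_pairing ((1 - fps_X ^ 2) * H) ?B = (\<Sum>k. fps_nth H k * cnj (fps_nth ?B k)) - (\<Sum>k. ?t k)"
      unfolding fps_pairing_def suminf_diff[OF sH st] by (simp add: left_diff_distrib)
    also have "(\<Sum>k. ?t k) = (\<Sum>k. ?t (k + 2))"
      using suminf_split_initial_segment[OF st, of 2] by (simp add: fps_X_power_mult_nth)
    also have "(\<Sum>k. fps_nth H k * cnj (fps_nth ?B k)) - \<dots> =
        (\<Sum>k. fps_nth H k * cnj (fps_nth ?B k) - ?t (k + 2))"
      by (rule suminf_diff[OF sH]) (use summable_ignore_initial_segment[OF st] in blast)
    finally show ?thesis by (simp add: fps_X_power_mult_nth right_diff_distrib)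
  qed
  ultimately have "1 = norm (\<Sum>k. fps_nth H k * cnj (fps_nth ?B k - fps_nth ?B (k + 2)))"
    using pair by simp
  also have "\<dots> \<le> (\<Sum>k. norm (taylor_coeff h k) * ?N)"
  proof (rule norm_suminf_le)
    show "norm (fps_nth H k * cnj (fps_nth ?B k - fps_nth ?B (k + 2))) \<le> norm (taylor_coeff h k) * ?N" for k
      unfolding norm_mult nthH complex_mod_cnj
      by (intro mult_left_mono norm_blaschke_diff_le) (use l in auto)
    show "summable (\<lambda>k. norm (taylor_coeff h k) * ?N)" by (intro summable_mult2 sm)
  qed
  also have "\<dots> = wiener_norm h * ?N"
    unfolding wiener_norm_def using sm by (rule suminf_mult2[symmetric])
  finally show ?thesis .
qed

text \<open>
  The infimum of an empty set of reals is unspecified, so a lower bound for \<open>phi\<close> requires an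
  admissible function.
\<close>

lemma prod_linear_admissible:
  fixes n :: nat and l :: "nat \<Rightarrow> complex"
  defines "h \<equiv> \<lambda>z. \<Prod>i=1..n. l i - z"
  shows "h \<in> wiener_algebra" "i \<in> {1..n} \<Longrightarrow> zero_of_order_at_least h (l i) (card {j\<in>{1..n}. l j = l i})"
proof -
  have hol: "h holomorphic_on S" for S unfolding h_def by (intro holomorphic_intros)
  have exp: "h has_fps_expansion (\<Prod>i=1..n. fps_const (l i) - fps_X)"
    unfolding h_def by (intro fps_expansion_intros)
  have "fps_conv_radius (fps_const (l i) - fps_X) = \<infinity>" for i
    using fps_conv_radius_diff[of "fps_const (l i)" fps_X] by simp
  then have "fps_conv_radius (\<Prod>i=1..n. fps_const (l i) - fps_X) = \<infinity>"
    by (intro fps_conv_radius_prod_infinity)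
  then have "summable (\<lambda>k. norm (fps_nth (\<Prod>i=1..n. fps_const (l i) - fps_X) k))"
    by (intro summable_norm_fps_nth) simp
  then show "h \<in> wiener_algebra"
    using hol unfolding wiener_algebra_def taylor_coeff_def fps_nth_fps_expansion[OF exp] by simp
  show "zero_of_order_at_least h (l i) (card {j\<in>{1..n}. l j = l i})"
  proof (rule factor_imp_zero_of_order_at_least[where S = UNIV])
    let ?J = "{j\<in>{1..n}. l j = l i}"
    show "(\<lambda>z. (-1) ^ card ?J * (\<Prod>j\<in>{1..n} - ?J. l j - z)) holomorphic_on UNIV"
      by (intro holomorphic_intros)
    fix z
    have "h z = (\<Prod>j\<in>?J. l j - z) * (\<Prod>j\<in>{1..n} - ?J. l j - z)"
      unfolding h_def by (subst prod.subset_diff[of ?J]) (auto simp: mult.commute)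
    also have "(\<Prod>j\<in>?J. l j - z) = (\<Prod>j\<in>?J. (-1) * (z - l i))" by (intro prod.cong) auto
    also have "\<dots> = (z - l i) ^ card ?J * (-1) ^ card ?J" 
      unfolding prod_constant power_mult_distrib by (rule mult.commute)
    finally show "h z = (z - l i) ^ card ?J * ((-1) ^ card ?J * (\<Prod>j\<in>{1..n} - ?J. l j - z))"
      by (simp add: mult.assoc)
  qed auto
qed

theorem mainTheorem5:
  fixes n :: nat and l :: "nat \<Rightarrow> complex"
  assumes "n \<ge> 1"
    and "\<And>i. i \<in> {1..n} \<Longrightarrow> l i \<in> ball 0 1 - {0}"
  shows "phi n l \<ge>
    1 / linf_norm (\<lambda>z. (1 - z\<^sup>2) * blaschke_product n l z) - (\<Prod>i=1..n. norm (l i))"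
  unfolding phi_def
proof (rule cInf_greatest, goal_cases)
  case 1
  let ?h = "\<lambda>z. \<Prod>i=1..n. l i - z"
  have "wiener_norm ?h - norm (?h 0) \<in> {wiener_norm h - norm (h 0) | h.
     h \<in> wiener_algebra \<and> h 0 = (\<Prod>i=1..n. l i) \<and>
     (\<forall>i\<in>{1..n}. zero_of_order_at_least h (l i) (card {j\<in>{1..n}. l j = l i}))}"
    by (intro CollectI exI[of _ ?h] conjI ballI refl prod_linear_admissible) simp_all
  then show ?case by (rule ex_in_conv[THEN iffD1, OF exI])
next
  case (2 x)
  let ?N = "linf_norm (\<lambda>z. (1 - z\<^sup>2) * blaschke_product n l z)"
  from 2 obtain h where x: "x = wiener_norm h - norm (h 0)" and h: "h \<in> wiener_algebra"
    "h 0 = (\<Prod>i=1..n. l i)"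
    "\<And>i. i \<in> {1..n} \<Longrightarrow> zero_of_order_at_least h (l i) (card {j\<in>{1..n}. l j = l i})" by blast
  have le: "1 \<le> wiener_norm h * ?N"
    by (rule one_le_wiener_norm_mult_linf_norm) (use assms(2) h in auto)
  have "wiener_norm h \<ge> 0"
    using h(1) unfolding wiener_norm_def wiener_algebra_def by (intro suminf_nonneg) auto
  then have "?N > 0" using le mult_nonneg_nonpos[of "wiener_norm h" ?N] by linarith
  then have "1 / ?N \<le> wiener_norm h" using le by (simp add: field_simps)
  then show ?case using x h(2) by (simp add: prod_norm)
qed

end
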